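(* Let $f\in\Gamma_0(\mathbb{R}^n)$ and $\mu>0$. Then the following are equivalent: (i) $\operatorname{rge}\partial f\supseteq\operatorname{rge}\nabla\phi$, and for all $(\bar x,\bar v)\in\operatorname{gph}\partial f\cap(\mathbb{R}^n\times\operatorname{int}\operatorname{dom}\phi^* )$ the following anisotropic strong convexity inequality holds: $$f(x)\ge f(\bar x)+\tfrac1\mu\star\phi\big(x-\bar x+\mu^{-1}\nabla\phi^*(\bar v)\big)-\tfrac1\mu\star\phi\big(\mu^{-1}\nabla\phi^*(\bar v)\big)\quad\forall x\in\mathbb{R}^n;$$ (ii) $\operatorname{dom}f^*\supseteq\operatorname{dom}\phi^*$ and $f^*$ is smooth relative to $\phi^*$ in the Bregman sense with constant $\mu^{-1}$, i.e., $\mu^{-1}\phi^*-f^*$ is convex on $\operatorname{int}\operatorname{dom}\phi^*$.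
   Context: $\Gamma_0(\mathbb{R}^n)$: proper lower semicontinuous convex functions $\mathbb{R}^n\to\overline{\mathbb{R}}$; $h^*$ is the convex conjugate; $\operatorname{rge}$ denotes range and $\operatorname{gph}$ graph; $\partial f$ is the convex subdifferential. Standing assumption: $\phi\in\Gamma_0(\mathbb{R}^n)$ has $\operatorname{dom}\phi=\mathbb{R}^n$ and is Legendre (essentially smooth and essentially strictly convex in the sense of Rockafellar); so $\nabla\phi:\mathbb{R}^n\to\operatorname{int}\operatorname{dom}\phi^*$ is a bijection with inverse $\nabla\phi^*$. For $\lambda>0$, $(\lambda\star\phi)(x)=\lambda\phi(\lambda^{-1}x)$. *)

theory Defs
  imports "HOL-Analysis.Analysis"
begin

definition edom :: "('a \<Rightarrow> ereal) \<Rightarrow> 'a set" where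
  "edom f = {x. f x < \<infinity>}"

text \<open>Convexity of an extended-real-valued function on a set, by convexity of its epigraph
  over that set. This includes convexity of \<open>S \<inter> edom h\<close>, and it avoids evaluating
  \<open>\<infinity> - \<infinity>\<close> in a Jensen inequality.\<close>

definition econvex_on :: "'a::real_vector set \<Rightarrow> ('a \<Rightarrow> ereal) \<Rightarrow> bool" where
  "econvex_on S h \<longleftrightarrow> convex {(x, r::real). x \<in> S \<and> h x \<le> ereal r}"

definition proper :: "('a \<Rightarrow> ereal) \<Rightarrow> bool" where
  "proper f \<longleftrightarrow> (\<forall>x. f x \<noteq> -\<infinity>) \<and> edom f \<noteq> {}"

definition lsc :: "('a::topological_space \<Rightarrow> ereal) \<Rightarrow> bool" where
  "lsc f \<longleftrightarrow> (\<forall>x. f x \<le> Liminf (at x) f)"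

definition Gamma0 :: "('a::euclidean_space \<Rightarrow> ereal) set" where
  "Gamma0 = {f. proper f \<and> lsc f \<and> econvex_on UNIV f}"

definition conjugate :: "('a::real_inner \<Rightarrow> ereal) \<Rightarrow> 'a \<Rightarrow> ereal" where
  "conjugate f v = (SUP x. ereal (v \<bullet> x) - f x)"

text \<open>For proper \<open>f\<close> this is empty outside \<open>edom f\<close>.\<close>

definition subdifferential :: "('a::real_inner \<Rightarrow> ereal) \<Rightarrow> 'a \<Rightarrow> 'a set" where
  "subdifferential f x = {v. \<forall>y. f y \<ge> f x + ereal (v \<bullet> (y - x))}"

text \<open>The conversion to real values is harmless for the derivative, because \<open>f\<close> is required
  to be finite in a neighbourhood of \<open>x\<close>.\<close>

definition has_gradient :: "('a::real_inner \<Rightarrow> ereal) \<Rightarrow> 'a \<Rightarrow> 'a \<Rightarrow> bool" where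
  "has_gradient f x g \<longleftrightarrow>
     x \<in> interior {y. \<bar>f y\<bar> \<noteq> \<infinity>} \<and> GDERIV (\<lambda>y. real_of_ereal (f y)) x :> g"

text \<open>Only meaningful at points where \<open>f\<close> is differentiable.\<close>

definition gradient :: "('a::real_inner \<Rightarrow> ereal) \<Rightarrow> 'a \<Rightarrow> 'a" where
  "gradient f x = (THE g. has_gradient f x g)"

definition essentially_smooth :: "('a::real_inner \<Rightarrow> ereal) \<Rightarrow> bool" where
  "essentially_smooth f \<longleftrightarrow>
     interior (edom f) \<noteq> {} \<and>
     (\<forall>x \<in> interior (edom f). \<exists>g. has_gradient f x g) \<and>
     (\<forall>X x. (\<forall>k. X k \<in> interior (edom f)) \<and> X \<longlonglongrightarrow> x \<and> x \<in> frontier (interior (edom f)) \<longrightarrow>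
        filterlim (\<lambda>k::nat. norm (gradient f (X k))) at_top sequentially)"

definition essentially_strictly_convex :: "('a::real_inner \<Rightarrow> ereal) \<Rightarrow> bool" where
  "essentially_strictly_convex f \<longleftrightarrow>
     (\<forall>C. convex C \<and> C \<subseteq> {x. subdifferential f x \<noteq> {}} \<longrightarrow>
        (\<forall>x\<in>C. \<forall>y\<in>C. \<forall>t::real. x \<noteq> y \<and> 0 < t \<and> t < 1 \<longrightarrow>
           f ((1 - t) *\<^sub>R x + t *\<^sub>R y) < ereal (1 - t) * f x + ereal t * f y))"

definition Legendre :: "('a::real_inner \<Rightarrow> ereal) \<Rightarrow> bool" where
  "Legendre f \<longleftrightarrow> essentially_smooth f \<and> essentially_strictly_convex f"

text \<open>Epi-scaling \<open>l \<star> f\<close>, intended for \<open>l > 0\<close>.\<close>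

definition epi_scale :: "real \<Rightarrow> ('a::real_vector \<Rightarrow> ereal) \<Rightarrow> 'a \<Rightarrow> ereal" where
  "epi_scale l f x = ereal l * f (inverse l *\<^sub>R x)"

text \<open>The first conjunct makes \<open>h\<close> less than \<open>\<infinity>\<close> on \<open>interior (edom p)\<close>, so for proper \<open>h\<close>
  and \<open>p\<close> the difference is one of real numbers there.\<close>

definition bregman_smooth ::
    "real \<Rightarrow> ('a::real_normed_vector \<Rightarrow> ereal) \<Rightarrow> ('a \<Rightarrow> ereal) \<Rightarrow> bool" where
  "bregman_smooth L p h \<longleftrightarrow>
     edom p \<subseteq> edom h \<and> econvex_on (interior (edom p)) (\<lambda>v. ereal L * p v - h v)"

end

theory Submission
  imports Defs
begin

text \<open>
  Fix \<open>vbar \<in> \<partial>f(xbar)\<close> in the interior \<open>S\<close> of \<open>dom \<phi>\<^sup>*\<close> and put \<open>y = \<nabla>\<phi>\<^sup>*(vbar)\<close>.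
  The anisotropic inequality bounds \<open>f\<close> from below by a shifted copy of
  \<open>x \<mapsto> \<phi>(\<mu> x) / \<mu>\<close>, and conjugation turns it into the upper bound
  \<open>f\<^sup>*(v) \<le> \<mu>\<^sup>-\<^sup>1 \<phi>\<^sup>*(v) + \<langle>v, xbar - \<mu>\<^sup>-\<^sup>1 y\<rangle> - c\<close> with equality at \<open>vbar\<close>. Nothing is lost in this step
  (\<open>conjugate_le_of_anisotropic_minorant\<close>, \<open>anisotropic_minorant_of_conjugate_le\<close>): every
  value of \<open>\<phi>\<close> is recovered from \<open>\<phi>\<^sup>*\<close> on \<open>S\<close>, because \<open>S\<close> is the range of \<open>\<nabla>\<phi>\<close>.
  The bound says that \<open>g = \<mu>\<^sup>-\<^sup>1 \<phi>\<^sup>* - f\<^sup>*\<close> has an affine minorant that touches it at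
  \<open>vbar\<close>, with slope \<open>\<mu>\<^sup>-\<^sup>1 y - xbar\<close>.

  From minorants to convexity: if the range of \<open>\<partial>f\<close> covers \<open>S\<close>, then \<open>g\<close> has such a minorant at
  every point of \<open>S\<close>, hence is convex there, and a single one of these bounds already gives
  \<open>dom \<phi>\<^sup>* \<subseteq> dom f\<^sup>*\<close>. From convexity to minorants: \<open>xbar\<close> is a subgradient of \<open>f\<^sup>*\<close> at
  \<open>vbar\<close>, so \<open>g\<close> lies below the function
  \<open>v \<mapsto> \<mu>\<^sup>-\<^sup>1 \<phi>\<^sup>*(v) - f\<^sup>*(vbar) - \<langle>xbar, v - vbar\<rangle>\<close>, which is differentiable and touches \<open>g\<close> at
  \<open>vbar\<close>. A convex function lies above the tangent plane of a differentiable majorant that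
  touches it (\<open>convex_above_tangent_of_touching_majorant\<close>), and this tangent plane is the required
  minorant.

  That the range of \<open>\<partial>f\<close> contains the interior of
  \<open>dom f\<^sup>*\<close> holds because \<open>x \<mapsto> f(x) - \<langle>v, x\<rangle>\<close> is coercive for \<open>v\<close> in that interior and
  therefore attains its infimum. That \<open>\<phi>\<^sup>*\<close> is differentiable at \<open>\<nabla>\<phi>(y)\<close> with gradient
  \<open>y\<close> holds because \<open>y\<close> is a strict, hence by convexity and compactness a well-conditioned,
  minimum of \<open>x \<mapsto> \<phi>(x) - \<langle>\<nabla>\<phi>(y), x\<rangle>\<close>.
\<close>

section \<open>Tangent planes of convex functions\<close>

lemma GDERIV_line_tendsto:
  fixes u :: "'a::real_inner \<Rightarrow> real"
  assumes "GDERIV u x :> g"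
  shows "((\<lambda>t. (u (x + t *\<^sub>R d) - u x) / t) \<longlongrightarrow> g \<bullet> d) (at_right 0)"
proof -
  have u: "(u has_derivative (\<lambda>h. h \<bullet> g)) (at (x + 0 *\<^sub>R d))"
    using assms by (simp add: gderiv_def)
  have l: "((\<lambda>t. x + t *\<^sub>R d) has_derivative (\<lambda>t. t *\<^sub>R d)) (at 0)"
    by (auto intro!: derivative_eq_intros)
  have "((\<lambda>t. u (x + t *\<^sub>R d)) has_derivative (\<lambda>t. (t *\<^sub>R d) \<bullet> g)) (at 0)"
    using has_derivative_compose[OF l u] .
  then have "((\<lambda>t. u (x + t *\<^sub>R d)) has_real_derivative (g \<bullet> d)) (at 0)"
    by (simp add: has_field_derivative_def inner_commute mult_commute_abs)
  then show ?thesis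
    by (auto simp: DERIV_def intro: filterlim_mono[OF _ order_refl at_le])
qed

text \<open>
  The point \<open>x\<close> lies between \<open>y\<close> and a point slightly beyond \<open>x\<close>. Convexity bounds
  \<open>k y\<close> from below by the value of \<open>k\<close> at that further point, which is at most the value of \<open>u\<close>,
  and the difference quotient of \<open>u\<close> converges to the slope \<open>g\<close>.
  With \<open>u = k\<close> this is the gradient inequality; with \<open>k\<close> affine it identifies subgradients
  of differentiable functions.
\<close>

lemma convex_above_tangent_of_touching_majorant:
  fixes k u :: "'a::real_inner \<Rightarrow> real"
  assumes "convex_on S k" and "open S" and "x \<in> S" and "y \<in> S"
    and maj: "\<And>z. z \<in> S \<Longrightarrow> k z \<le> u z" and touch: "k x = u x"
    and "GDERIV u x :> g"
  shows "k x + g \<bullet> (y - x) \<le> k y"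
proof -
  define d where "d = x - y"
  have lim: "((\<lambda>t. (u (x + t *\<^sub>R d) - u x) / t) \<longlongrightarrow> g \<bullet> d) (at_right 0)"
    by (rule GDERIV_line_tendsto) fact
  have "((\<lambda>t. x + t *\<^sub>R d) \<longlongrightarrow> x) (at_right (0::real))"
    by (auto intro!: tendsto_eq_intros)
  then have "eventually (\<lambda>t. x + t *\<^sub>R d \<in> S) (at_right (0::real))"
    using \<open>open S\<close> \<open>x \<in> S\<close> topological_tendstoD by blast
  moreover have "eventually (\<lambda>t. t > 0) (at_right (0::real))"
    by (rule eventually_at_right_less)
  ultimately have "eventually (\<lambda>t. k x - k y \<le> (u (x + t *\<^sub>R d) - u x) / t) (at_right 0)"
  proof eventually_elim
    case (elim t)
    define s where "s = 1 / (1 + t)"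
    have s: "0 \<le> s" "s \<le> 1" "(1 + t) * s = 1" using elim by (auto simp: s_def)
    \<comment> \<open>The weight \<open>s = 1 / (1 + t)\<close> makes \<open>x\<close> the combination of \<open>y\<close> and \<open>x + t (x - y)\<close>.\<close>
    have "(1 + t) *\<^sub>R ((1 - s) *\<^sub>R y + s *\<^sub>R (x + t *\<^sub>R d))
        = (1 + t - (1 + t) * s) *\<^sub>R y + ((1 + t) * s) *\<^sub>R (x + t *\<^sub>R d)"
      by (simp add: algebra_simps)
    also have "\<dots> = (1 + t) *\<^sub>R x"
      unfolding s(3) d_def by (simp add: algebra_simps)
    finally have x: "(1 - s) *\<^sub>R y + s *\<^sub>R (x + t *\<^sub>R d) = x"
      using elim by simp
    have "k ((1 - s) *\<^sub>R y + s *\<^sub>R (x + t *\<^sub>R d)) \<le> (1 - s) * k y + s * k (x + t *\<^sub>R d)"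
      using convex_onD[OF assms(1)] s elim assms(4) by blast
    then have "k x \<le> (1 - s) * k y + s * k (x + t *\<^sub>R d)"
      using x by simp
    then have "(1 + t) * k x \<le> (1 + t) * ((1 - s) * k y + s * k (x + t *\<^sub>R d))"
      using elim by simp
    also have "\<dots> = (1 + t - (1 + t) * s) * k y + ((1 + t) * s) * k (x + t *\<^sub>R d)"
      by (simp add: algebra_simps)
    also have "\<dots> \<le> t * k y + u (x + t *\<^sub>R d)"
      using maj[of "x + t *\<^sub>R d"] elim unfolding s(3) by simp
    finally have "t * (k x - k y) \<le> u (x + t *\<^sub>R d) - u x"
      using touch by (simp add: algebra_simps)
    then show ?case using elim by (simp add: field_simps)
  qed
  then have "k x - k y \<le> g \<bullet> d"
    using lim by (intro tendsto_lowerbound) auto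
  then show ?thesis by (simp add: d_def inner_diff_right)
qed

lemma convex_above_tangent:
  fixes p :: "'a::real_inner \<Rightarrow> real"
  assumes "convex_on UNIV p" and "GDERIV p x :> g"
  shows "p x + g \<bullet> (y - x) \<le> p y"
  using convex_above_tangent_of_touching_majorant[OF assms(1) open_UNIV, of x y p g] assms(2)
  by simp

lemma touching_affine_minorant_slope:
  fixes p :: "'a::real_inner \<Rightarrow> real"
  assumes min: "\<And>y. p x + v \<bullet> (y - x) \<le> p y" and "GDERIV p x :> g"
  shows "v = g"
proof -
  have "convex_on UNIV (\<lambda>y. p x + v \<bullet> (y - x))"
    by (intro convex_onI) (auto simp: algebra_simps inner_simps)
  from convex_above_tangent_of_touching_majorant[OF this open_UNIV, of x "x + (g - v)" p g]
  have "g \<bullet> (g - v) \<le> v \<bullet> (g - v)"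
    using assms by simp
  then have "(g - v) \<bullet> (g - v) \<le> 0" by (simp add: inner_diff_left)
  then show ?thesis using inner_ge_zero[of "g - v"] by (simp add: antisym)
qed

section \<open>Conjugates and subgradients\<close>

lemma Fenchel_Young: "ereal (v \<bullet> x) - f x \<le> conjugate f v"
  unfolding conjugate_def by (rule SUP_upper) simp

lemma conjugate_leI:
  assumes "\<And>x. ereal (v \<bullet> x) - f x \<le> c"
  shows "conjugate f v \<le> c"
  unfolding conjugate_def using assms by (intro SUP_least)

lemma conjugate_not_MInfty:
  assumes "proper f"
  shows "conjugate f v \<noteq> -\<infinity>"
proof -
  obtain x where "f x < \<infinity>" using assms by (auto simp: proper_def edom_def)
  moreover have "f x \<noteq> -\<infinity>" using assms by (auto simp: proper_def)
  ultimately have "ereal (v \<bullet> x) - f x \<noteq> -\<infinity>" by (cases "f x") auto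
  then show ?thesis using Fenchel_Young[of v x f] by auto
qed

lemma subdifferential_imp_finite:
  assumes "proper f" and "v \<in> subdifferential f x"
  shows "\<exists>a. f x = ereal a"
proof -
  obtain y where y: "f y < \<infinity>" using assms(1) by (auto simp: proper_def edom_def)
  have "f x + ereal (v \<bullet> (y - x)) \<le> f y" using assms(2) by (simp add: subdifferential_def)
  then have "f x \<noteq> \<infinity>" using y by auto
  then show ?thesis using assms(1) by (cases "f x") (auto simp: proper_def)
qed

lemma conjugate_at_subgradient:
  assumes "f x = ereal a" and "v \<in> subdifferential f x"
  shows "conjugate f v = ereal (v \<bullet> x - a)"
proof (rule antisym)
  show "conjugate f v \<le> ereal (v \<bullet> x - a)"
  proof (rule conjugate_leI)
    fix y
    have "ereal (a + v \<bullet> (y - x)) \<le> f y"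
      using assms by (auto simp: subdifferential_def)
    then show "ereal (v \<bullet> y) - f y \<le> ereal (v \<bullet> x - a)"
      by (cases "f y") (auto simp: inner_diff_right)
  qed
  show "ereal (v \<bullet> x - a) \<le> conjugate f v"
    using Fenchel_Young[of v x f] assms(1) by simp
qed

lemma convex_edom_conjugate:
  assumes "proper f"
  shows "convex (edom (conjugate f))"
proof (rule convexI)
  fix v w :: 'a and s t :: real
  assume vw: "v \<in> edom (conjugate f)" "w \<in> edom (conjugate f)"
    and st: "0 \<le> s" "0 \<le> t" "s + t = 1"
  obtain a b where ab: "conjugate f v = ereal a" "conjugate f w = ereal b"
    using vw conjugate_not_MInfty[OF assms] unfolding edom_def
    by (metis (mono_tags) ereal_cases less_irrefl mem_Collect_eq)
  have "conjugate f (s *\<^sub>R v + t *\<^sub>R w) \<le> ereal (s * a + t * b)"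
  proof (rule conjugate_leI)
    fix x
    show "ereal ((s *\<^sub>R v + t *\<^sub>R w) \<bullet> x) - f x \<le> ereal (s * a + t * b)"
    proof (cases "f x")
      case (real r)
      have "v \<bullet> x - r \<le> a" "w \<bullet> x - r \<le> b"
        using Fenchel_Young[of v x f] Fenchel_Young[of w x f] ab real by auto
      then have "s * (v \<bullet> x - r) + t * (w \<bullet> x - r) \<le> s * a + t * b"
        using st by (intro add_mono mult_left_mono)
      moreover have "s * (v \<bullet> x - r) + t * (w \<bullet> x - r) = s * (v \<bullet> x) + t * (w \<bullet> x) - (s + t) * r"
        by (simp add: algebra_simps)
      ultimately show ?thesis using real st by (simp add: inner_add_left)
    qed (use assms in \<open>auto simp: proper_def\<close>)
  qed
  then show "s *\<^sub>R v + t *\<^sub>R w \<in> edom (conjugate f)"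
    by (auto simp: edom_def)
qed

section \<open>Subgradients from the interior of the domain of the conjugate\<close>

text \<open>
  The punctured limit inferior in the definition of \<open>lsc\<close> says nothing about the point \<open>x\<close> itself;
  the assumption \<open>c < f x\<close> adds it.
\<close>

lemma lsc_eventually_gt:
  assumes "lsc f" and "c < f x"
  shows "eventually (\<lambda>y. c < f y) (nhds x)"
proof -
  have "c < Liminf (at x) f"
    using assms by (metis lsc_def order_less_le_trans)
  then have "eventually (\<lambda>y. c < f y) (at x)"
    by (rule less_LiminfD)
  then show ?thesis using assms(2)
    by (simp add: eventually_nhds_conv_at)
qed

text \<open>
  The conjugate is finite at the finitely many points \<open>v \<plusminus> e b\<close> with \<open>b\<close> in the basis. The
  Fenchel-Young inequality at these points bounds \<open>f x - v \<bullet> x\<close> from below by \<open>e \<bar>x \<bullet> b\<bar> - M\<close>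
  for every \<open>b\<close>, and averaging over \<open>b\<close> gives linear growth in the norm.
\<close>

lemma growth_of_interior_dom_conjugate:
  fixes f :: "'a::euclidean_space \<Rightarrow> ereal"
  assumes "proper f" and "v \<in> interior (edom (conjugate f))"
  obtains e M where "e > 0" "\<And>x. ereal (v \<bullet> x + e * norm x - M) \<le> f x"
proof -
  obtain e where e: "e > 0" "cball v e \<subseteq> edom (conjugate f)"
    using assms(2) by (metis mem_interior_cball)
  define W where "W = (\<lambda>b. v + e *\<^sub>R b) ` Basis \<union> (\<lambda>b. v - e *\<^sub>R b) ` Basis"
  have W: "finite W" "W \<noteq> {}" by (auto simp: W_def)
  have "W \<subseteq> cball v e"
    using e(1) by (auto simp: W_def dist_norm)
  then have "Max (conjugate f ` W) < \<infinity>"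
    using W e(2) by (subst Max_less_iff) (auto simp: edom_def)
  then obtain M where "Max (conjugate f ` W) \<le> ereal M"
    by (cases "Max (conjugate f ` W)") auto
  then have M: "conjugate f w \<le> ereal M" if "w \<in> W" for w
    using that W by auto
  let ?n = "real DIM('a)"
  have n: "?n > 0" by simp
  have "ereal (v \<bullet> x + e / ?n * norm x - M) \<le> f x" for x
  proof (cases "f x")
    case (real r)
    have "e * \<bar>x \<bullet> b\<bar> - M \<le> r - v \<bullet> x" if "b \<in> Basis" for b
    proof -
      have "v + e *\<^sub>R b \<in> W" "v - e *\<^sub>R b \<in> W"
        using that by (auto simp: W_def)
      then have "ereal ((v + e *\<^sub>R b) \<bullet> x) - f x \<le> ereal M"
          "ereal ((v - e *\<^sub>R b) \<bullet> x) - f x \<le> ereal M"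
        using Fenchel_Young M order_trans by blast+
      then show ?thesis using real
        by (cases "x \<bullet> b \<ge> 0") (auto simp: inner_simps inner_commute)
    qed
    then have "(\<Sum>b\<in>(Basis::'a set). e * \<bar>x \<bullet> b\<bar> - M) \<le> (\<Sum>b\<in>(Basis::'a set). r - v \<bullet> x)"
      by (rule sum_mono)
    moreover have "e * norm x \<le> e * (\<Sum>b\<in>Basis. \<bar>x \<bullet> b\<bar>)"
      using e(1) norm_le_l1 by auto
    ultimately have "e * norm x - ?n * M \<le> ?n * (r - v \<bullet> x)"
      by (simp add: sum_subtractf sum_distrib_left)
    then have "e / ?n * norm x - M \<le> r - v \<bullet> x"
      using n by (simp add: field_simps)
    then show ?thesis using real by simp
  qed (use assms in \<open>auto simp: proper_def\<close>)
  with e(1) n show thesis by (intro that[of "e / ?n" M]) auto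
qed

text \<open>
  A subgradient relation \<open>v \<in> \<partial>f(x)\<close> means that \<open>x\<close> minimizes \<open>f - \<langle>v, \<cdot>\<rangle>\<close>. By the
  linear growth above, minimizing sequences are bounded, and by lower semicontinuity their cluster
  points are minimizers. The infimum is \<open>-f\<^sup>*(v)\<close>, called \<open>-m\<close> below.
\<close>

lemma interior_dom_conjugate_subset_range_subdifferential:
  fixes f :: "'a::euclidean_space \<Rightarrow> ereal"
  assumes "proper f" and "lsc f"
  shows "interior (edom (conjugate f)) \<subseteq> (\<Union>x. subdifferential f x)"
proof
  fix v assume v: "v \<in> interior (edom (conjugate f))"
  obtain e M where e: "e > 0" and growth: "\<And>x. ereal (v \<bullet> x + e * norm x - M) \<le> f x"
    by (rule growth_of_interior_dom_conjugate[OF assms(1) v]) blast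
  have "v \<in> edom (conjugate f)" using v interior_subset by blast
  then obtain m where m: "conjugate f v = ereal m"
    using conjugate_not_MInfty[OF assms(1), of v] by (cases "conjugate f v") (auto simp: edom_def)
  have "\<exists>x. ereal (m - inverse (real (Suc n))) < ereal (v \<bullet> x) - f x" for n
  proof -
    have "ereal (m - inverse (real (Suc n))) < conjugate f v" using m by simp
    then show ?thesis unfolding conjugate_def by (simp add: less_SUP_iff)
  qed
  then obtain X where X: "\<And>n. ereal (m - inverse (real (Suc n))) < ereal (v \<bullet> X n) - f (X n)"
    by metis
  have fX: "f (X n) \<le> ereal (v \<bullet> X n - m + inverse (real (Suc n)))" for n
    using X[of n] by (cases "f (X n)") auto
  have "e * norm (X n) \<le> M - m + 1" for n
  proof -
    have "ereal (v \<bullet> X n + e * norm (X n) - M) \<le> ereal (v \<bullet> X n - m + inverse (real (Suc n)))"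
      using growth[of "X n"] fX[of n] by (rule order_trans)
    moreover have "inverse (real (Suc n)) \<le> 1" by (simp add: inverse_le_1_iff)
    ultimately show ?thesis by simp
  qed
  then have "norm (X n) \<le> (M - m + 1) / e" for n
    using e by (simp add: field_simps)
  then have "bounded (range X)" by (auto simp: bounded_iff)
  then obtain x s where s: "strict_mono s" and lim: "(X \<circ> s) \<longlonglongrightarrow> x"
    using bounded_imp_convergent_subsequence by blast
  have "f x \<le> ereal (v \<bullet> x - m)"
  proof (rule ccontr)
    assume "\<not> f x \<le> ereal (v \<bullet> x - m)"
    then have "ereal (v \<bullet> x - m) < f x" by simp
    then obtain c where c: "v \<bullet> x - m < c" "ereal c < f x"
      using ereal_dense2 by force
    have ev: "eventually (\<lambda>n. ereal c < f ((X \<circ> s) n)) sequentially"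
      by (rule eventually_compose_filterlim[OF lsc_eventually_gt[OF assms(2) c(2)] lim])
    have "(\<lambda>n. inverse (real (Suc (s n)))) \<longlonglongrightarrow> 0"
      using LIMSEQ_subseq_LIMSEQ[OF LIMSEQ_inverse_real_of_nat s] by (simp add: o_def)
    moreover have "(\<lambda>n. X (s n)) \<longlonglongrightarrow> x" using lim by (simp add: o_def)
    ultimately have "(\<lambda>n. v \<bullet> X (s n) - m + inverse (real (Suc (s n)))) \<longlonglongrightarrow> v \<bullet> x - m + 0"
      by (intro tendsto_intros)
    then have "eventually (\<lambda>n. v \<bullet> X (s n) - m + inverse (real (Suc (s n))) < c) sequentially"
      using c(1) by (intro order_tendstoD(2)) auto
    with ev have "eventually (\<lambda>n. False) sequentially"
    proof eventually_elim
      case (elim n)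
      have "ereal c < ereal (v \<bullet> X (s n) - m + inverse (real (Suc (s n))))"
        using elim(1) fX[of "s n"] by (auto simp del: ereal_less less_ereal.simps)
      then show ?case using elim(2) by simp
    qed
    then show False by simp
  qed
  moreover have above: "ereal (v \<bullet> y - m) \<le> f y" for y
    using Fenchel_Young[of v y f] m by (cases "f y") auto
  ultimately have fx: "f x = ereal (v \<bullet> x - m)" by (intro antisym)
  have "v \<in> subdifferential f x"
    using above by (simp add: subdifferential_def fx inner_diff_right)
  then show "v \<in> (\<Union>x. subdifferential f x)" by blast
qed

section \<open>Differentiability of the conjugate at a strict minimum\<close>

text \<open>
  On the compact sphere of radius \<open>r\<close> the excess over the minimum is at least \<open>d r\<close> for some \<open>d > 0\<close>;
  along each ray, convexity makes the excess grow at least linearly from there on.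
\<close>

lemma convex_strict_minimum_linear_growth:
  fixes h :: "'a::euclidean_space \<Rightarrow> real"
  assumes "convex_on UNIV h" and "continuous_on UNIV h"
    and strict: "\<And>y. y \<noteq> x \<Longrightarrow> h x < h y" and "r > 0"
  obtains d where "d > 0" "\<And>y. r \<le> norm (y - x) \<Longrightarrow> h x + d * norm (y - x) \<le> h y"
proof -
  have "\<exists>z\<in>sphere x r. \<forall>y\<in>sphere x r. h z \<le> h y"
    using assms(2) \<open>r > 0\<close>
    by (intro continuous_attains_inf) (auto intro: continuous_on_subset)
  then obtain z where z: "z \<in> sphere x r" and zmin: "\<And>y. y \<in> sphere x r \<Longrightarrow> h z \<le> h y"
    by blast
  define d where "d = (h z - h x) / r"
  have "z \<noteq> x" using z \<open>r > 0\<close> by auto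
  then have "d > 0" using strict \<open>r > 0\<close> by (simp add: d_def)
  moreover have "h x + d * norm (y - x) \<le> h y" if y: "r \<le> norm (y - x)" for y
  proof -
    define t where "t = r / norm (y - x)"
    have N: "norm (y - x) > 0" using y \<open>r > 0\<close> by linarith
    have t: "0 < t" "t \<le> 1" "t * norm (y - x) = r"
      using y \<open>r > 0\<close> N by (auto simp: t_def simp del: zero_less_norm_iff)
    have eq: "(1 - t) *\<^sub>R x + t *\<^sub>R y - x = t *\<^sub>R (y - x)" by (simp add: algebra_simps)
    have "norm ((1 - t) *\<^sub>R x + t *\<^sub>R y - x) = r"
      unfolding eq using t by simp
    then have "(1 - t) *\<^sub>R x + t *\<^sub>R y \<in> sphere x r"
      by (simp add: dist_norm norm_minus_commute)
    then have "h z \<le> h ((1 - t) *\<^sub>R x + t *\<^sub>R y)" by (rule zmin)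
    also have "\<dots> \<le> (1 - t) * h x + t * h y"
      using convex_onD[OF assms(1), of t x y] t by simp
    finally have "h z - h x \<le> t * (h y - h x)" by (simp add: algebra_simps)
    moreover have "h z - h x = d * (t * norm (y - x))"
      using t(3) \<open>r > 0\<close> by (simp add: d_def)
    ultimately have "t * (d * norm (y - x)) \<le> t * (h y - h x)"
      by (simp add: mult.left_commute)
    then show ?thesis using t(1) by simp
  qed
  ultimately show thesis by (rule that)
qed

text \<open>
  For every \<open>r > 0\<close> the linear growth of \<open>p - \<langle>v, \<cdot>\<rangle>\<close> outside the ball of radius \<open>r\<close> about \<open>x\<close>
  has some slope \<open>d\<close>. A tilt by \<open>w - v\<close> of norm below \<open>d\<close> cannot overcome this growth, and
  inside the ball it gains at most \<open>r \<parallel>w - v\<parallel>\<close>. So \<open>\<langle>x, w - v\<rangle>\<close> is a first-order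
  approximation of the increment of the conjugate with relative error at most \<open>r\<close>, which is
  differentiability at \<open>v\<close>; finiteness near \<open>v\<close> is the case \<open>r = 1\<close>.
\<close>

lemma conjugate_differentiable_at_strict_minimum:
  fixes p :: "'a::euclidean_space \<Rightarrow> real"
  assumes "convex_on UNIV p" and "continuous_on UNIV p"
    and strict: "\<And>y. y \<noteq> x \<Longrightarrow> p x + v \<bullet> (y - x) < p y"
  shows "has_gradient (conjugate (\<lambda>y. ereal (p y))) v x"
proof -
  let ?q = "conjugate (\<lambda>y. ereal (p y))"
  have lower: "ereal (v \<bullet> x - p x + x \<bullet> (w - v)) \<le> ?q w" for w
    using Fenchel_Young[of w x "\<lambda>y. ereal (p y)"]
    by (simp add: inner_diff_right inner_commute)
  have upper: "\<exists>d>0. \<forall>w. norm (w - v) < d \<longrightarrow>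
      ?q w \<le> ereal (v \<bullet> x - p x + x \<bullet> (w - v) + r * norm (w - v))" if r: "r > 0" for r
  proof -
    have "convex_on UNIV (\<lambda>y. p y + - v \<bullet> y)"
      using assms(1) by (intro convex_on_add) (auto intro!: convex_onI simp: inner_simps algebra_simps)
    moreover have "continuous_on UNIV (\<lambda>y. p y + - v \<bullet> y)"
      using assms(2) by (intro continuous_intros)
    moreover have "p x + - v \<bullet> x < p y + - v \<bullet> y" if "y \<noteq> x" for y
      using strict[OF that] by (simp add: inner_simps)
    ultimately obtain d where d: "d > 0"
      "\<And>y. r \<le> norm (y - x) \<Longrightarrow> p x + - v \<bullet> x + d * norm (y - x) \<le> p y + - v \<bullet> y"
      using convex_strict_minimum_linear_growth[of "\<lambda>y. p y + - v \<bullet> y" x r] r by blast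
    have "?q w \<le> ereal (v \<bullet> x - p x + x \<bullet> (w - v) + r * norm (w - v))" if w: "norm (w - v) < d" for w
    proof (rule conjugate_leI)
      fix y
      have cs: "(w - v) \<bullet> (y - x) \<le> norm (w - v) * norm (y - x)" by (rule norm_cauchy_schwarz)
      have "p x + v \<bullet> (y - x) + (w - v) \<bullet> (y - x) \<le> p y + r * norm (w - v)"
      proof (cases "r \<le> norm (y - x)")
        case True
        have "norm (w - v) * norm (y - x) \<le> d * norm (y - x)"
          using w by (intro mult_right_mono) auto
        moreover have "0 \<le> r * norm (w - v)" using r by simp
        ultimately show ?thesis using d(2)[OF True] cs by (simp add: inner_simps)
      next
        case False
        have "norm (w - v) * norm (y - x) \<le> norm (w - v) * r"
          using False by (intro mult_left_mono) auto
        moreover have "p x + v \<bullet> (y - x) \<le> p y"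
          using strict[of y] by (cases "y = x") auto
        ultimately show ?thesis using cs by (simp add: mult.commute)
      qed
      then show "ereal (w \<bullet> y) - ereal (p y)
          \<le> ereal (v \<bullet> x - p x + x \<bullet> (w - v) + r * norm (w - v))"
        by (simp add: inner_simps inner_commute)
    qed
    with d(1) show ?thesis by blast
  qed
  obtain d where d: "d > 0" "\<And>w. norm (w - v) < d \<Longrightarrow>
      ?q w \<le> ereal (v \<bullet> x - p x + x \<bullet> (w - v) + 1 * norm (w - v))"
    using upper[of 1] by auto
  have qv: "?q v = ereal (v \<bullet> x - p x)"
  proof (rule antisym)
    show "?q v \<le> ereal (v \<bullet> x - p x)" using d(2)[of v] d(1) by simp
    show "ereal (v \<bullet> x - p x) \<le> ?q v" using lower[of v] by simp
  qed
  have fin: "\<bar>?q w\<bar> \<noteq> \<infinity>" if "?q w \<le> ereal c" for w c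
    using that lower[of w] by (cases "?q w") auto
  have "ball v d \<subseteq> {w. \<bar>?q w\<bar> \<noteq> \<infinity>}"
  proof
    fix w assume "w \<in> ball v d"
    then have "norm (w - v) < d" by (simp add: dist_norm norm_minus_commute)
    then show "w \<in> {w. \<bar>?q w\<bar> \<noteq> \<infinity>}" using fin[OF d(2)] by simp
  qed
  then have "v \<in> interior {w. \<bar>?q w\<bar> \<noteq> \<infinity>}"
    using d(1) mem_interior by blast
  moreover have "((\<lambda>w. real_of_ereal (?q w)) has_derivative (\<lambda>h. h \<bullet> x)) (at v)"
    unfolding has_derivative_at_alt
  proof (intro conjI allI impI)
    show "bounded_linear (\<lambda>h. h \<bullet> x)" by (rule bounded_linear_inner_left)
    fix r :: real assume "r > 0"
    then obtain d where d: "d > 0" "\<And>w. norm (w - v) < d \<Longrightarrow>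
        ?q w \<le> ereal (v \<bullet> x - p x + x \<bullet> (w - v) + r * norm (w - v))"
      using upper[of r] by auto
    have "norm (real_of_ereal (?q w) - real_of_ereal (?q v) - (w - v) \<bullet> x) \<le> r * norm (w - v)"
      if "norm (w - v) < d" for w
      using d(2)[OF that] lower[of w] qv
      by (cases "?q w") (auto simp: inner_commute)
    with d(1) show "\<exists>d>0. \<forall>w. norm (w - v) < d \<longrightarrow>
        norm (real_of_ereal (?q w) - real_of_ereal (?q v) - (w - v) \<bullet> x) \<le> r * norm (w - v)"
      by blast
  qed
  ultimately show ?thesis by (simp add: has_gradient_def gderiv_def)
qed

section \<open>Legendre functions with full domain\<close>

lemma gradient_eqI:
  assumes "has_gradient f x g"
  shows "gradient f x = g"
  unfolding gradient_def
proof (rule the_equality)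
  show "has_gradient f x g" by fact
  fix g' assume "has_gradient f x g'"
  then have "(\<lambda>h. h \<bullet> g') = (\<lambda>h. h \<bullet> g)"
    using assms unfolding has_gradient_def gderiv_def by (blast intro: has_derivative_unique)
  then have "(g' - g) \<bullet> g' = (g' - g) \<bullet> g" by metis
  then have "(g' - g) \<bullet> (g' - g) = 0" by (simp add: inner_diff_right)
  then show "g' = g" by simp
qed

lemma econvex_on_ereal_imp_convex_on:
  assumes "econvex_on S (\<lambda>x. ereal (p x))" and "convex S"
  shows "convex_on S p"
proof (rule convex_onI)
  fix t :: real and x y
  assume t: "0 < t" "t < 1" and xy: "x \<in> S" "y \<in> S"
  have "(1 - t) *\<^sub>R (x, p x) + t *\<^sub>R (y, p y) \<in> {(x, r::real). x \<in> S \<and> ereal (p x) \<le> ereal r}"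
    using assms(1) t xy unfolding econvex_on_def by (intro convexD) auto
  then show "p ((1 - t) *\<^sub>R x + t *\<^sub>R y) \<le> (1 - t) * p x + t * p y" by simp
qed fact

text \<open>
  A Legendre function with full domain is an ordinary real function \<open>p\<close>. The gradient is a
  subgradient at every point, so essential strict convexity is strict convexity on the whole space,
  and the gradient inequality is strict: compare it at the midpoint with strict convexity.
\<close>

lemma Legendre_full_domain_obtain:
  fixes \<phi> :: "'a::euclidean_space \<Rightarrow> ereal"
  assumes "\<phi> \<in> Gamma0" and "edom \<phi> = UNIV" and "Legendre \<phi>"
  obtains p where "\<phi> = (\<lambda>x. ereal (p x))" and "convex_on UNIV p"
    and "\<And>x. GDERIV p x :> gradient \<phi> x"
    and "\<And>x y. y \<noteq> x \<Longrightarrow> p x + gradient \<phi> x \<bullet> (y - x) < p y"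
proof -
  define p where "p = (\<lambda>x. real_of_ereal (\<phi> x))"
  have "\<bar>\<phi> x\<bar> \<noteq> \<infinity>" for x
    using assms(1,2) by (cases "\<phi> x") (auto simp: Gamma0_def proper_def edom_def)
  then have p: "\<phi> = (\<lambda>x. ereal (p x))" by (auto simp: p_def ereal_real)
  have conv: "convex_on UNIV p"
    using assms(1) p by (intro econvex_on_ereal_imp_convex_on) (auto simp: Gamma0_def)
  have grad: "GDERIV p x :> gradient \<phi> x" for x
  proof -
    have "\<exists>g. has_gradient \<phi> x g"
      using assms(2,3) by (auto simp: Legendre_def essentially_smooth_def)
    then have "has_gradient \<phi> x (gradient \<phi> x)" using gradient_eqI by metis
    then show ?thesis by (simp add: has_gradient_def p_def)
  qed
  have tangent: "p x + gradient \<phi> x \<bullet> (y - x) \<le> p y" for x y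
    by (rule convex_above_tangent[OF conv grad])
  then have "gradient \<phi> x \<in> subdifferential \<phi> x" for x
    by (simp add: subdifferential_def p)
  then have "UNIV \<subseteq> {x. subdifferential \<phi> x \<noteq> {}}" by auto
  then have "\<phi> ((1 - t) *\<^sub>R x + t *\<^sub>R y) < ereal (1 - t) * \<phi> x + ereal t * \<phi> y"
    if "x \<noteq> y" "0 < t" "t < 1" for x y t
    using assms(3) that convex_UNIV UNIV_I
    unfolding Legendre_def essentially_strictly_convex_def by blast
  then have sconv: "p ((1 - t) *\<^sub>R x + t *\<^sub>R y) < (1 - t) * p x + t * p y"
    if "x \<noteq> y" "0 < t" "t < 1" for x y t
    using that by (simp add: p)
  have "p x + gradient \<phi> x \<bullet> (y - x) < p y" if "y \<noteq> x" for x y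
  proof -
    have "p x + gradient \<phi> x \<bullet> (((1 - 1/2) *\<^sub>R x + (1/2) *\<^sub>R y) - x) \<le> p ((1 - 1/2) *\<^sub>R x + (1/2) *\<^sub>R y)"
      by (rule tangent)
    also have "\<dots> < (1 - 1/2) * p x + (1/2) * p y"
      using that by (intro sconv) auto
    finally show ?thesis by (simp add: inner_simps algebra_simps)
  qed
  with p conv grad show thesis by (rule that)
qed

lemma Legendre_has_gradient_conjugate:
  fixes \<phi> :: "'a::euclidean_space \<Rightarrow> ereal"
  assumes "\<phi> \<in> Gamma0" and "edom \<phi> = UNIV" and "Legendre \<phi>"
  shows "has_gradient (conjugate \<phi>) (gradient \<phi> y) y"
proof -
  obtain p where p: "\<phi> = (\<lambda>x. ereal (p x))" "convex_on UNIV p"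
    "\<And>x. GDERIV p x :> gradient \<phi> x"
    "\<And>x y. y \<noteq> x \<Longrightarrow> p x + gradient \<phi> x \<bullet> (y - x) < p y"
    using Legendre_full_domain_obtain[OF assms] by metis
  have "continuous_on UNIV p"
    using p(3) unfolding gderiv_def
    by (blast intro: continuous_at_imp_continuous_on has_derivative_continuous)
  from conjugate_differentiable_at_strict_minimum[OF p(2) this p(4)]
  show ?thesis unfolding p(1)[symmetric] .
qed

text \<open>
  A gradient lies in the interior because the conjugate is finite around it, by the
  differentiability just shown; conversely, a point of the interior is a subgradient somewhere, and
  the only subgradient of a differentiable function is its gradient.
\<close>

lemma Legendre_range_gradient:
  fixes \<phi> :: "'a::euclidean_space \<Rightarrow> ereal"
  assumes "\<phi> \<in> Gamma0" and "edom \<phi> = UNIV" and "Legendre \<phi>"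
  shows "range (gradient \<phi>) = interior (edom (conjugate \<phi>))"
proof
  have "{w. \<bar>conjugate \<phi> w\<bar> \<noteq> \<infinity>} \<subseteq> edom (conjugate \<phi>)" by (auto simp: edom_def)
  from interior_mono[OF this] show "range (gradient \<phi>) \<subseteq> interior (edom (conjugate \<phi>))"
    using Legendre_has_gradient_conjugate[OF assms] by (auto simp: has_gradient_def)
  obtain p where p: "\<phi> = (\<lambda>x. ereal (p x))" "\<And>x. GDERIV p x :> gradient \<phi> x"
    using Legendre_full_domain_obtain[OF assms] by metis
  have "v = gradient \<phi> x" if "v \<in> subdifferential \<phi> x" for v x
    using that by (intro touching_affine_minorant_slope[OF _ p(2)]) (simp add: subdifferential_def p(1))
  then have "(\<Union>x. subdifferential \<phi> x) \<subseteq> range (gradient \<phi>)" by blast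
  moreover have "interior (edom (conjugate \<phi>)) \<subseteq> (\<Union>x. subdifferential \<phi> x)"
    using assms(1)
    by (intro interior_dom_conjugate_subset_range_subdifferential) (auto simp: Gamma0_def)
  ultimately show "interior (edom (conjugate \<phi>)) \<subseteq> range (gradient \<phi>)" by blast
qed

lemma Legendre_conjugate_at_gradient:
  fixes \<phi> :: "'a::euclidean_space \<Rightarrow> ereal"
  assumes "\<phi> \<in> Gamma0" and "edom \<phi> = UNIV" and "Legendre \<phi>" and "\<phi> y = ereal b"
  shows "conjugate \<phi> (gradient \<phi> y) = ereal (gradient \<phi> y \<bullet> y - b)"
proof (rule conjugate_at_subgradient)
  obtain p where p: "\<phi> = (\<lambda>x. ereal (p x))"
    "\<And>x y. y \<noteq> x \<Longrightarrow> p x + gradient \<phi> x \<bullet> (y - x) < p y"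
    using Legendre_full_domain_obtain[OF assms(1-3)] by metis
  have "p y + gradient \<phi> y \<bullet> (z - y) \<le> p z" for z
    using p(2)[of z y] by (cases "z = y") auto
  then show "gradient \<phi> y \<in> subdifferential \<phi> y"
    by (simp add: subdifferential_def p(1))
qed fact

section \<open>Dualizing the anisotropic minorant\<close>

text \<open>
  Epi-scaling by \<open>1 / \<mu>\<close> is \<open>x \<mapsto> \<phi>(\<mu> x) / \<mu>\<close>, and the factor \<open>\<mu>\<close> cancels against
  \<open>\<mu>\<^sup>-\<^sup>1\<close> in the shift. The right-hand side is free of subtraction in \<open>ereal\<close>.
\<close>

lemma anisotropic_bound_iff:
  assumes "f xbar = ereal a" and "\<phi> = (\<lambda>x. ereal (p x))" and "\<mu> > 0"
  shows "f xbar + epi_scale (1 / \<mu>) \<phi> (x - xbar + inverse \<mu> *\<^sub>R y)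
            - epi_scale (1 / \<mu>) \<phi> (inverse \<mu> *\<^sub>R y) \<le> f x
     \<longleftrightarrow> ereal (a - p y / \<mu> + p (\<mu> *\<^sub>R (x - xbar) + y) / \<mu>) \<le> f x"
  using assms(3)
  by (simp add: assms(1,2) epi_scale_def scaleR_right_distrib algebra_simps)

text \<open>
  Conjugation reverses inequalities, and substituting \<open>z = \<mu> (x - a) + y\<close> in the supremum
  shows that the right-hand side is the conjugate of the minorant.
\<close>

lemma conjugate_le_of_anisotropic_minorant:
  fixes f :: "'a::real_inner \<Rightarrow> ereal"
  assumes "\<mu> > 0" and min: "\<And>x. ereal (c + p (\<mu> *\<^sub>R (x - a) + y) / \<mu>) \<le> f x"
  shows "conjugate f v \<le> ereal (inverse \<mu>) * conjugate (\<lambda>x. ereal (p x)) v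
           + ereal (v \<bullet> (a - inverse \<mu> *\<^sub>R y) - c)"
proof (cases "conjugate (\<lambda>x. ereal (p x)) v")
  case (real q)
  have "conjugate f v \<le> ereal (inverse \<mu> * q + (v \<bullet> (a - inverse \<mu> *\<^sub>R y) - c))"
  proof (rule conjugate_leI)
    fix x
    define z where "z = \<mu> *\<^sub>R (x - a) + y"
    have "v \<bullet> z - p z \<le> q" using Fenchel_Young[of v z "\<lambda>x. ereal (p x)"] real by simp
    then have "inverse \<mu> * (v \<bullet> z - p z) \<le> inverse \<mu> * q"
      using assms(1) by (intro mult_left_mono) auto
    moreover have "inverse \<mu> *\<^sub>R z = x - (a - inverse \<mu> *\<^sub>R y)"
      using assms(1) by (simp add: z_def scaleR_add_right)
    then have "inverse \<mu> * (v \<bullet> z) = v \<bullet> x - v \<bullet> (a - inverse \<mu> *\<^sub>R y)"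
      by (metis inner_diff_right inner_scaleR_right)
    ultimately have "v \<bullet> x - (c + p z / \<mu>) \<le> inverse \<mu> * q + (v \<bullet> (a - inverse \<mu> *\<^sub>R y) - c)"
      by (simp add: right_diff_distrib divide_inverse mult.commute)
    then show "ereal (v \<bullet> x) - f x \<le> ereal (inverse \<mu> * q + (v \<bullet> (a - inverse \<mu> *\<^sub>R y) - c))"
      using min[of x] by (cases "f x") (auto simp: z_def)
  qed
  then show ?thesis using real by simp
next
  case PInf
  then show ?thesis using assms(1) by simp
next
  case MInf
  then show ?thesis using Fenchel_Young[of v 0 "\<lambda>x. ereal (p x)"] by simp
qed

text \<open>
  The bound is used only at \<open>v = \<nabla>\<phi>(z)\<close> with \<open>z = \<mu> (x - a) + y\<close>. There the
  Fenchel-Young inequality for \<open>\<phi>\<close> is an equality, so the one for \<open>f\<close> yields the value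
  \<open>\<phi>(z)\<close> without loss.
\<close>

lemma anisotropic_minorant_of_conjugate_le:
  fixes f \<phi> :: "'a::euclidean_space \<Rightarrow> ereal"
  assumes "\<phi> \<in> Gamma0" and "edom \<phi> = UNIV" and "Legendre \<phi>"
    and p: "\<phi> = (\<lambda>x. ereal (p x))" and "\<mu> > 0"
    and bound: "\<And>v. v \<in> interior (edom (conjugate \<phi>)) \<Longrightarrow>
      conjugate f v \<le> ereal (inverse \<mu>) * conjugate \<phi> v + ereal (v \<bullet> (a - inverse \<mu> *\<^sub>R y) - c)"
  shows "ereal (c + p (\<mu> *\<^sub>R (x - a) + y) / \<mu>) \<le> f x"
proof -
  define z where "z = \<mu> *\<^sub>R (x - a) + y"
  define v where "v = gradient \<phi> z"
  have v: "v \<in> interior (edom (conjugate \<phi>))"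
    using Legendre_range_gradient[OF assms(1-3)] by (auto simp: v_def)
  have "conjugate \<phi> v = ereal (v \<bullet> z - p z)"
    unfolding v_def by (rule Legendre_conjugate_at_gradient[OF assms(1-3)]) (simp add: p)
  then have "conjugate f v \<le> ereal (inverse \<mu> * (v \<bullet> z - p z) + (v \<bullet> (a - inverse \<mu> *\<^sub>R y) - c))"
    using bound[OF v] by simp
  moreover have "inverse \<mu> *\<^sub>R z = x - (a - inverse \<mu> *\<^sub>R y)"
    using assms(5) by (simp add: z_def scaleR_add_right)
  then have "inverse \<mu> * (v \<bullet> z) = v \<bullet> x - v \<bullet> (a - inverse \<mu> *\<^sub>R y)"
    by (metis inner_diff_right inner_scaleR_right)
  then have "inverse \<mu> * (v \<bullet> z - p z) + (v \<bullet> (a - inverse \<mu> *\<^sub>R y) - c) = v \<bullet> x - (c + p z / \<mu>)"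
    by (simp add: right_diff_distrib divide_inverse mult.commute)
  ultimately have "ereal (v \<bullet> x) - f x \<le> ereal (v \<bullet> x - (c + p z / \<mu>))"
    using Fenchel_Young[of v x f] by simp
  then show ?thesis by (cases "f x") (auto simp: z_def)
qed

section \<open>The equivalence\<close>

text \<open>
  A function on a convex set that has a touching affine minorant at every point is convex: use
  the minorant at the point that divides the segment.
\<close>

lemma bregman_smooth_of_anisotropic_minorants:
  fixes f \<phi> :: "'a::euclidean_space \<Rightarrow> ereal"
  assumes "\<phi> \<in> Gamma0" and "edom \<phi> = UNIV" and "Legendre \<phi>"
    and p: "\<phi> = (\<lambda>x. ereal (p x))" and "proper f" and "\<mu> > 0"
    and range: "interior (edom (conjugate \<phi>)) \<subseteq> (\<Union>x. subdifferential f x)"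
    and minorant: "\<And>xbar vbar a x. f xbar = ereal a \<Longrightarrow> vbar \<in> subdifferential f xbar \<Longrightarrow>
      vbar \<in> interior (edom (conjugate \<phi>)) \<Longrightarrow>
      ereal (a - p (gradient (conjugate \<phi>) vbar) / \<mu>
        + p (\<mu> *\<^sub>R (x - xbar) + gradient (conjugate \<phi>) vbar) / \<mu>) \<le> f x"
  shows "bregman_smooth (inverse \<mu>) (conjugate \<phi>) (conjugate f)"
proof -
  let ?S = "interior (edom (conjugate \<phi>))"
  let ?g = "\<lambda>v. ereal (inverse \<mu>) * conjugate \<phi> v - conjugate f v"
  have "proper \<phi>" using assms(1) by (simp add: Gamma0_def)
  \<comment> \<open>At each \<open>u\<close> the function \<open>g\<close> has the touching affine minorant \<open>v \<mapsto> c - v \<bullet> w\<close>;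
    stated without
    subtraction, it also bounds \<open>f\<^sup>*\<close> where this is not yet known to be finite.\<close>
  have dual: "\<exists>w c. (\<forall>v. conjugate f v \<le> ereal (inverse \<mu>) * conjugate \<phi> v + ereal (v \<bullet> w - c))
      \<and> ?g u = ereal (c - u \<bullet> w)" if u: "u \<in> ?S" for u
  proof -
    obtain x where x: "u \<in> subdifferential f x" using range u by blast
    obtain a where a: "f x = ereal a" using subdifferential_imp_finite[OF \<open>proper f\<close> x] by blast
    obtain y where y: "u = gradient \<phi> y"
      using Legendre_range_gradient[OF assms(1-3)] u by blast
    have grad: "gradient (conjugate \<phi>) u = y"
      unfolding y by (rule gradient_eqI[OF Legendre_has_gradient_conjugate[OF assms(1-3)]])
    define w where "w = x - inverse \<mu> *\<^sub>R y"
    define c where "c = a - p y / \<mu>"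
    have "conjugate f v \<le> ereal (inverse \<mu>) * conjugate \<phi> v + ereal (v \<bullet> w - c)" for v
      unfolding p w_def
      by (rule conjugate_le_of_anisotropic_minorant[OF assms(6)])
        (use minorant[OF a x u] grad in \<open>simp add: c_def\<close>)
    moreover have "conjugate \<phi> u = ereal (u \<bullet> y - p y)"
      unfolding y by (rule Legendre_conjugate_at_gradient[OF assms(1-3)]) (simp add: p)
    then have "?g u = ereal (c - u \<bullet> w)"
      using conjugate_at_subgradient[of f x a u, OF a x]
      by (simp add: c_def w_def inner_simps algebra_simps divide_inverse)
    ultimately show ?thesis by blast
  qed
  have "gradient \<phi> 0 \<in> ?S"
    using Legendre_range_gradient[OF assms(1-3)] by blast
  from dual[OF this] obtain w c where
    wc: "\<And>v. conjugate f v \<le> ereal (inverse \<mu>) * conjugate \<phi> v + ereal (v \<bullet> w - c)" by blast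
  have dom: "edom (conjugate \<phi>) \<subseteq> edom (conjugate f)"
  proof
    fix v assume "v \<in> edom (conjugate \<phi>)"
    then have "ereal (inverse \<mu>) * conjugate \<phi> v + ereal (v \<bullet> w - c) < \<infinity>"
      using conjugate_not_MInfty[OF \<open>proper \<phi>\<close>, of v]
      by (cases "conjugate \<phi> v") (auto simp: edom_def)
    then show "v \<in> edom (conjugate f)"
      using wc[of v] unfolding edom_def by (auto intro: le_less_trans)
  qed
  have "econvex_on ?S ?g"
    unfolding econvex_on_def
  proof (rule convexI)
    fix P Q :: "'a \<times> real" and s t :: real
    assume PQ: "P \<in> {(v, r). v \<in> ?S \<and> ?g v \<le> ereal r}" "Q \<in> {(v, r). v \<in> ?S \<and> ?g v \<le> ereal r}"
      and st: "0 \<le> s" "0 \<le> t" "s + t = 1"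
    obtain v\<^sub>1 r\<^sub>1 v\<^sub>2 r\<^sub>2 where P: "P = (v\<^sub>1, r\<^sub>1)" and Q: "Q = (v\<^sub>2, r\<^sub>2)"
      by (metis surj_pair)
    have v: "v\<^sub>1 \<in> ?S" "v\<^sub>2 \<in> ?S" and r: "?g v\<^sub>1 \<le> ereal r\<^sub>1" "?g v\<^sub>2 \<le> ereal r\<^sub>2"
      using PQ P Q by auto
    let ?u = "s *\<^sub>R v\<^sub>1 + t *\<^sub>R v\<^sub>2"
    have u: "?u \<in> ?S"
      using convex_interior[OF convex_edom_conjugate[OF \<open>proper \<phi>\<close>]] v st by (rule convexD)
    from dual[OF u] obtain w c where
      wc: "\<And>v. conjugate f v \<le> ereal (inverse \<mu>) * conjugate \<phi> v + ereal (v \<bullet> w - c)"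
      and gu: "?g ?u = ereal (c - ?u \<bullet> w)" by blast
    have below: "c - v \<bullet> w \<le> r" if "v \<in> ?S" "?g v \<le> ereal r" for v r
    proof -
      have "v \<in> edom (conjugate \<phi>)" "v \<in> edom (conjugate f)"
        using that(1) dom interior_subset by blast+
      then obtain F q where "conjugate f v = ereal F" "conjugate \<phi> v = ereal q"
        using conjugate_not_MInfty[OF \<open>proper f\<close>, of v] conjugate_not_MInfty[OF \<open>proper \<phi>\<close>, of v]
        by (cases "conjugate f v"; cases "conjugate \<phi> v") (auto simp: edom_def)
      then show ?thesis using that(2) wc[of v] by simp
    qed
    have "s * (c - v\<^sub>1 \<bullet> w) + t * (c - v\<^sub>2 \<bullet> w) \<le> s * r\<^sub>1 + t * r\<^sub>2"
      using below[OF v(1) r(1)] below[OF v(2) r(2)] st by (intro add_mono mult_left_mono)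
    moreover have "s * (c - v\<^sub>1 \<bullet> w) + t * (c - v\<^sub>2 \<bullet> w) = (s + t) * c - ?u \<bullet> w"
      by (simp add: algebra_simps inner_simps)
    ultimately have "c - ?u \<bullet> w \<le> s * r\<^sub>1 + t * r\<^sub>2" using st by simp
    then have "?g ?u \<le> ereal (s * r\<^sub>1 + t * r\<^sub>2)" using gu by simp
    with u show "s *\<^sub>R P + t *\<^sub>R Q \<in> {(v, r). v \<in> ?S \<and> ?g v \<le> ereal r}"
      by (simp add: P Q)
  qed
  with dom show ?thesis by (simp add: bregman_smooth_def)
qed

text \<open>
  After dualizing, the claim is that \<open>G = \<mu>\<^sup>-\<^sup>1 \<phi>\<^sup>* - f\<^sup>*\<close> lies above an affine function that
  agrees with it at \<open>vbar\<close>. The subgradient \<open>xbar\<close> of \<open>f\<^sup>*\<close> only bounds \<open>G\<close> from above, by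
  a differentiable function; the convexity of \<open>G\<close> turns this into the lower bound.
\<close>

lemma anisotropic_minorant_of_bregman_smooth:
  fixes f \<phi> :: "'a::euclidean_space \<Rightarrow> ereal"
  assumes "\<phi> \<in> Gamma0" and "edom \<phi> = UNIV" and "Legendre \<phi>"
    and p: "\<phi> = (\<lambda>x. ereal (p x))" and "proper f" and "\<mu> > 0"
    and smooth: "bregman_smooth (inverse \<mu>) (conjugate \<phi>) (conjugate f)"
    and a: "f xbar = ereal a" and sub: "vbar \<in> subdifferential f xbar"
    and vbar: "vbar \<in> interior (edom (conjugate \<phi>))"
  shows "ereal (a - p (gradient (conjugate \<phi>) vbar) / \<mu>
        + p (\<mu> *\<^sub>R (x - xbar) + gradient (conjugate \<phi>) vbar) / \<mu>) \<le> f x"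
proof (rule anisotropic_minorant_of_conjugate_le[OF assms(1-4) \<open>\<mu> > 0\<close>])
  let ?S = "interior (edom (conjugate \<phi>))"
  define F where "F = (\<lambda>v. real_of_ereal (conjugate f v))"
  define q where "q = (\<lambda>v. real_of_ereal (conjugate \<phi> v))"
  define G where "G = (\<lambda>v. inverse \<mu> * q v - F v)"
  have "proper \<phi>" using assms(1) by (simp add: Gamma0_def)
  have fin: "conjugate f v = ereal (F v)" "conjugate \<phi> v = ereal (q v)" if "v \<in> ?S" for v
  proof -
    have "v \<in> edom (conjugate \<phi>)" using that interior_subset by blast
    moreover from this have "v \<in> edom (conjugate f)" using smooth by (auto simp: bregman_smooth_def)
    ultimately show "conjugate f v = ereal (F v)" "conjugate \<phi> v = ereal (q v)"
      using conjugate_not_MInfty[OF \<open>proper f\<close>, of v] conjugate_not_MInfty[OF \<open>proper \<phi>\<close>, of v]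
      by (cases "conjugate f v"; cases "conjugate \<phi> v"; auto simp: edom_def F_def q_def)+
  qed
  obtain y where y: "vbar = gradient \<phi> y"
    using Legendre_range_gradient[OF assms(1-3)] vbar by blast
  have hg: "has_gradient (conjugate \<phi>) vbar y"
    unfolding y by (rule Legendre_has_gradient_conjugate[OF assms(1-3)])
  then have grad: "gradient (conjugate \<phi>) vbar = y" by (rule gradient_eqI)
  have Fv: "F vbar = vbar \<bullet> xbar - a"
    using conjugate_at_subgradient[of f xbar a vbar, OF a sub] by (simp add: F_def)
  have qv: "q vbar = vbar \<bullet> y - p y"
    using Legendre_conjugate_at_gradient[OF assms(1-3), of y "p y"] y p by (simp add: q_def)
  \<comment> \<open>\<open>xbar\<close> is a subgradient of the conjugate of \<open>f\<close> at \<open>vbar\<close>; so the function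
    \<open>?u\<close> that follows is a majorant of \<open>G\<close>.\<close>
  have F_ge: "F vbar + xbar \<bullet> (v - vbar) \<le> F v" if "v \<in> ?S" for v
    using Fenchel_Young[of v xbar f] fin(1)[OF that] a Fv
    by (simp add: inner_diff_right inner_commute)
  have "econvex_on ?S (\<lambda>v. ereal (inverse \<mu>) * conjugate \<phi> v - conjugate f v)"
    using smooth by (simp add: bregman_smooth_def)
  also have "econvex_on ?S (\<lambda>v. ereal (inverse \<mu>) * conjugate \<phi> v - conjugate f v)
      \<longleftrightarrow> econvex_on ?S (\<lambda>v. ereal (G v))"
    unfolding econvex_on_def by (rule arg_cong[where f = convex]) (auto simp: fin G_def)
  finally have convG: "convex_on ?S G"
    using convex_interior[OF convex_edom_conjugate[OF \<open>proper \<phi>\<close>]]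
    by (rule econvex_on_ereal_imp_convex_on)
  let ?u = "\<lambda>v. inverse \<mu> * q v - (F vbar + xbar \<bullet> (v - vbar))"
  have "(q has_derivative (\<lambda>h. h \<bullet> y)) (at vbar)"
    using hg by (simp add: has_gradient_def gderiv_def q_def)
  then have "(?u has_derivative (\<lambda>h. inverse \<mu> * (h \<bullet> y) - xbar \<bullet> h)) (at vbar)"
    by (auto intro!: derivative_eq_intros)
  then have D: "GDERIV ?u vbar :> inverse \<mu> *\<^sub>R y - xbar"
    by (simp add: gderiv_def inner_simps inner_commute)
  have maj: "G v \<le> ?u v" if "v \<in> ?S" for v
    using F_ge[OF that] by (simp add: G_def)
  have touch: "G vbar = ?u vbar" by (simp add: G_def)
  have G_ge: "G vbar + (inverse \<mu> *\<^sub>R y - xbar) \<bullet> (v - vbar) \<le> G v" if "v \<in> ?S" for v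
    by (rule convex_above_tangent_of_touching_majorant[OF convG open_interior vbar that maj touch D])
  fix v assume v: "v \<in> ?S"
  have "F v \<le> inverse \<mu> * q v + (v \<bullet> (xbar - inverse \<mu> *\<^sub>R y) - (a - p y / \<mu>))"
    using G_ge[OF v] unfolding G_def Fv qv
    by (simp add: inner_simps inner_commute algebra_simps divide_inverse)
  then show "conjugate f v \<le> ereal (inverse \<mu>) * conjugate \<phi> v
      + ereal (v \<bullet> (xbar - inverse \<mu> *\<^sub>R gradient (conjugate \<phi>) vbar)
        - (a - p (gradient (conjugate \<phi>) vbar) / \<mu>))"
    by (simp add: fin[OF v] grad)
qed

theorem proposition5p11:
  fixes f \<phi> :: "real ^ 'n \<Rightarrow> ereal" and \<mu> :: real
  assumes "\<phi> \<in> Gamma0" and "edom \<phi> = UNIV" and "Legendre \<phi>"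
    and "f \<in> Gamma0" and "\<mu> > 0"
  shows
    "(range (gradient \<phi>) \<subseteq> (\<Union>x. subdifferential f x) \<and>
      (\<forall>xbar vbar. vbar \<in> subdifferential f xbar \<and> vbar \<in> interior (edom (conjugate \<phi>)) \<longrightarrow>
         (\<forall>x. f x \<ge> f xbar
            + epi_scale (1 / \<mu>) \<phi> (x - xbar + inverse \<mu> *\<^sub>R gradient (conjugate \<phi>) vbar)
            - epi_scale (1 / \<mu>) \<phi> (inverse \<mu> *\<^sub>R gradient (conjugate \<phi>) vbar))))
     \<longleftrightarrow> bregman_smooth (inverse \<mu>) (conjugate \<phi>) (conjugate f)"
    (is "?range \<and> ?minorants \<longleftrightarrow> ?smooth")
proof -
  have f: "proper f" "lsc f" using assms(4) by (auto simp: Gamma0_def)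
  obtain p where p: "\<phi> = (\<lambda>x. ereal (p x))"
    using Legendre_full_domain_obtain[OF assms(1-3)] by metis
  note range = Legendre_range_gradient[OF assms(1-3)]
  show ?thesis
  proof (intro iffI conjI)
    assume i: "?range \<and> ?minorants"
    show ?smooth
    proof (rule bregman_smooth_of_anisotropic_minorants[OF assms(1-3) p f(1) \<open>\<mu> > 0\<close>])
      show "interior (edom (conjugate \<phi>)) \<subseteq> (\<Union>x. subdifferential f x)"
        using i range by simp
      fix xbar vbar a x
      assume a: "f xbar = ereal a"
        and v: "vbar \<in> subdifferential f xbar" "vbar \<in> interior (edom (conjugate \<phi>))"
      have "f xbar + epi_scale (1 / \<mu>) \<phi> (x - xbar + inverse \<mu> *\<^sub>R gradient (conjugate \<phi>) vbar)
          - epi_scale (1 / \<mu>) \<phi> (inverse \<mu> *\<^sub>R gradient (conjugate \<phi>) vbar) \<le> f x"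
        using i v by blast
      then show "ereal (a - p (gradient (conjugate \<phi>) vbar) / \<mu>
          + p (\<mu> *\<^sub>R (x - xbar) + gradient (conjugate \<phi>) vbar) / \<mu>) \<le> f x"
        unfolding anisotropic_bound_iff[of f xbar a, OF a p \<open>\<mu> > 0\<close>] .
    qed
  next
    assume smooth: ?smooth
    then have "interior (edom (conjugate \<phi>)) \<subseteq> interior (edom (conjugate f))"
      by (intro interior_mono) (simp add: bregman_smooth_def)
    then show ?range
      using interior_dom_conjugate_subset_range_subdifferential[OF f] range by blast
    show ?minorants
    proof (intro allI impI, elim conjE)
      fix xbar vbar x
      assume v: "vbar \<in> subdifferential f xbar" "vbar \<in> interior (edom (conjugate \<phi>))"
      obtain a where a: "f xbar = ereal a"
        using subdifferential_imp_finite[OF f(1) v(1)] by blast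
      show "f xbar + epi_scale (1 / \<mu>) \<phi> (x - xbar + inverse \<mu> *\<^sub>R gradient (conjugate \<phi>) vbar)
          - epi_scale (1 / \<mu>) \<phi> (inverse \<mu> *\<^sub>R gradient (conjugate \<phi>) vbar) \<le> f x"
        unfolding anisotropic_bound_iff[of f xbar a, OF a p \<open>\<mu> > 0\<close>]
        by (rule anisotropic_minorant_of_bregman_smooth
            [OF assms(1-3) p f(1) \<open>\<mu> > 0\<close> smooth a v])
    qed
  qed
qed

end
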